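(* Let $k$ be a positive integer. Every finite nonempty digraph $D$ with minimum out-degree $\delta^+(D)\ge 2k-1$ contains $k$ pairwise vertex-disjoint near-directed cycles.
   Context: A digraph $D$ consists of a vertex set $V(D)$ and an arc set $A(D)\subseteq\{(u,v)\in V(D)\times V(D) : u\neq v\}$. Thus there are no loops and no parallel arcs, but antiparallel pairs $(u,v),(v,u)$ are allowed. An arc $(u,v)$ has tail $u$ and head $v$. The minimum out-degree $\delta^+(D)$ is the minimum over all $v\in V(D)$ of the number $|\{u : (v,u)\in A(D)\}|$ of out-neighbors of $v$. Cycles are treated as (not necessarily induced) subdigraphs of $D$. A directed cycle of length $\ell\ge 2$ consists of distinct vertices $v_1,\dots,v_\ell$ and the arcs $(v_1,v_2),\dots,(v_{\ell-1},v_\ell),(v_\ell,v_1)$. In particular, two vertices joined by a pair of antiparallel arcs form a directed cycle of length $2$. A (not necessarily directed) cycle of length $\ell\ge 3$ in $D$ consists of distinct vertices $v_1,\dots,v_\ell$ together with, for each $i$ (indices modulo $\ell$), exactly one arc of $D$ among $(v_i,v_{i+1})$ and $(v_{i+1},v_i)$. The only cycles of length $2$ are the directed ones. A cycle in $D$ is near-directed if either it is a directed cycle or it can be made into a directed cycle by reversing exactly one of its arcs. A near-directed cycle that is not directed necessarily has length at least $3$. *)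

theory Defs
  imports "Graph_Theory.Graph_Theory" "HOL-Library.Disjoint_Sets"
begin

text \<open>
  Arcs are pairs of vertices, so the out-degree of the library, which counts out-arcs, is the
  number of out-neighbours (lemma \<open>out_degree_eq_card_out_neighbours\<close>). The value is only
  meaningful for finite digraphs with at least one vertex.
\<close>
definition min_out_degree :: "'a pair_pre_digraph \<Rightarrow> nat" where
  "min_out_degree D = Min (out_degree (with_proj D) ` pverts D)"

text \<open>
  Cycles are digraphs in their own right, to be used as (not necessarily induced) subdigraphs,
  whereas \<open>pre_digraph.cycle\<close> is a predicate on arc walks.
  The vertex list is read cyclically: the vertex after \<open>vs ! i\<close> is
  \<open>vs ! (Suc i mod length vs)\<close>.
\<close>
definition directed_cycle :: "'a pair_pre_digraph \<Rightarrow> bool" where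
  "directed_cycle C \<longleftrightarrow>
     (\<exists>vs. 2 \<le> length vs \<and> distinct vs \<and> pverts C = set vs \<and>
       parcs C = {(vs ! i, vs ! (Suc i mod length vs)) | i. i < length vs})"

text \<open>
  For a cycle of length at least 3 the function \<open>a\<close> chooses, for each position, exactly one
  of the two possible orientations.
\<close>
definition is_cycle :: "'a pair_pre_digraph \<Rightarrow> bool" where
  "is_cycle C \<longleftrightarrow> directed_cycle C \<or>
     (\<exists>vs a. 3 \<le> length vs \<and> distinct vs \<and> pverts C = set vs \<and>
       (\<forall>i < length vs.
          a i = (vs ! i, vs ! (Suc i mod length vs)) \<or>
          a i = (vs ! (Suc i mod length vs), vs ! i)) \<and>
       parcs C = a ` {..<length vs})"

definition reverse_arc :: "'a \<times> 'a \<Rightarrow> 'a pair_pre_digraph \<Rightarrow> 'a pair_pre_digraph" where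
  "reverse_arc e C = C\<lparr>parcs := insert (prod.swap e) (parcs C - {e})\<rparr>"

definition near_directed_cycle :: "'a pair_pre_digraph \<Rightarrow> bool" where
  "near_directed_cycle C \<longleftrightarrow> is_cycle C \<and>
     (directed_cycle C \<or> (\<exists>e \<in> parcs C. directed_cycle (reverse_arc e C)))"

lemma out_degree_eq_card_out_neighbours:
  "out_degree (with_proj D) v = card {u. (v, u) \<in> parcs D}"
proof -
  have "out_arcs (with_proj D) v = Pair v ` {u. (v, u) \<in> parcs D}"
    by (auto simp: out_arcs_def)
  then show ?thesis
    by (simp add: out_degree_def card_image inj_on_def)
qed

lemma min_out_degree_ge_iff:
  assumes "pair_digraph D" and "pverts D \<noteq> {}"
  shows "m \<le> min_out_degree D \<longleftrightarrow> (\<forall>v \<in> pverts D. m \<le> card {u. (v, u) \<in> parcs D})"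
proof -
  interpret pair_digraph D by fact
  show ?thesis
    using assms(2) pair_finite_verts
    by (simp add: min_out_degree_def out_degree_eq_card_out_neighbours)
qed

end

(*
  Digons are removed one at a time, since every vertex loses at most two out-neighbours; so let D
  be an oriented graph. Among all families of disjoint near-directed cycles take one maximizing the
  sum of 3^(n - |C|), and subject to that one for which the uncovered set R contains a longest
  possible directed path P. Suppose there are fewer than k cycles, t of them triangles.

  A vertex with three out-neighbours on a cycle of length at least 4 lies on a shorter
  near-directed cycle, so a vertex of R has at most two out-neighbours on each long cycle and hence
  at least 2t + 1 out-neighbours in R and the triangles. If P misses a vertex of R, the end w of P
  and a vertex v of R - P with at most one out-neighbour in R send 5 arcs to some triangle xyz, say
  w -> x and v -> y, z; exchanging x and v makes P longer. So R = P. If arcs u1 -> w1 and u2 -> w2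
  are disjoint and their ends send 9 arcs to a triangle T, then T together with these four vertices
  contains two disjoint triangles. Applied to the last four vertices of P this gives |R| <= 3.
  As n >= 4k - 1, some cycle is long, and the same observation applies to four consecutive
  vertices of a longest one.
*)
theory Submission
  imports Defs
begin

section \<open>Near-directed cycles as vertex lists\<close>

definition dipath :: "('a \<times> 'a) set \<Rightarrow> 'a list \<Rightarrow> bool" where
  "dipath E vs \<longleftrightarrow> distinct vs \<and> successively (\<lambda>u v. (u, v) \<in> E) vs"

lemma dipath_conv_nth:
  "dipath E vs \<longleftrightarrow> distinct vs \<and> (\<forall>i. Suc i < length vs \<longrightarrow> (vs ! i, vs ! Suc i) \<in> E)"
  by (simp add: dipath_def successively_conv_nth)

text \<open>
  Deleting the one arc of a near-directed cycle that may have to be reversed leaves a directed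
  path through all its vertices.
\<close>
definition near_directed_list :: "('a \<times> 'a) set \<Rightarrow> 'a list \<Rightarrow> bool" where
  "near_directed_list E vs \<longleftrightarrow> dipath E vs \<and> 2 \<le> length vs \<and>
     ((last vs, hd vs) \<in> E \<or> 3 \<le> length vs \<and> (hd vs, last vs) \<in> E)"

text \<open>Disjointness and length depend on the vertex set alone, so packings are kept as families
  of vertex sets. The arcs are restored in \<open>near_directed_cycle_of_cycle_set\<close>.\<close>

definition cycle_set :: "('a \<times> 'a) set \<Rightarrow> 'a set \<Rightarrow> bool" where
  "cycle_set E X \<longleftrightarrow> (\<exists>vs. near_directed_list E vs \<and> set vs = X)"

lemma dipath_segment:
  assumes "dipath E vs" "a \<le> b" "b < length vs"
  obtains ws where "dipath E ws" "length ws = Suc b - a" "hd ws = vs ! a" "last ws = vs ! b"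
    "set ws \<subseteq> set vs"
proof
  let ?ws = "drop a (take (Suc b) vs)"
  show "length ?ws = Suc b - a" using assms by simp
  show "dipath E ?ws" using assms by (auto simp: dipath_conv_nth)
  show "hd ?ws = vs ! a" using assms by (simp add: hd_drop_conv_nth)
  show "last ?ws = vs ! b" using assms by (simp add: last_drop take_Suc_conv_app_nth)
  show "set ?ws \<subseteq> set vs" by (meson set_drop_subset set_take_subset subset_trans)
qed

lemma dipath_Cons:
  assumes "dipath E ws" "ws \<noteq> []" "v \<notin> set ws" "(v, hd ws) \<in> E"
  shows "dipath E (v # ws)"
  using assms by (auto simp: dipath_def successively_Cons)

lemma dipath_snoc:
  assumes "dipath E ws" "v \<notin> set ws" "ws \<noteq> [] \<Longrightarrow> (last ws, v) \<in> E"
  shows "dipath E (ws @ [v])"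
  using assms by (auto simp: dipath_def successively_append_iff)

lemma card_cycle_set:
  assumes "near_directed_list E vs"
  shows "card (set vs) = length vs"
  using assms by (simp add: near_directed_list_def dipath_conv_nth distinct_card)

text \<open>Put \<open>v\<close> in front of the segment from \<open>vs ! a\<close> to
  \<open>vs ! b\<close>; the arc from \<open>v\<close> to \<open>vs ! b\<close> is then the one to
  be reversed.\<close>

lemma cycle_set_of_two_out_neighbours:
  assumes "dipath E vs" "v \<notin> set vs" "a < b" "b < length vs" "(v, vs ! a) \<in> E" "(v, vs ! b) \<in> E"
  obtains X where "cycle_set E X" "X \<subseteq> insert v (set vs)" "card X = b - a + 2"
proof -
  obtain ws where ws: "dipath E ws" "length ws = Suc b - a" "hd ws = vs ! a" "last ws = vs ! b"
    "set ws \<subseteq> set vs"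
    using dipath_segment[OF assms(1), of a b] assms by auto
  have ne: "ws \<noteq> []" using ws assms by auto
  have "dipath E (v # ws)" using dipath_Cons[OF ws(1) ne] ws assms by auto
  then have nd: "near_directed_list E (v # ws)"
    using ws assms ne by (auto simp: near_directed_list_def)
  show ?thesis
  proof (rule that)
    show "cycle_set E (set (v # ws))" using nd by (auto simp: cycle_set_def)
    show "card (set (v # ws)) = b - a + 2" using card_cycle_set[OF nd] ws(2) assms(3) by simp
  qed (use ws(5) in auto)
qed

text \<open>A backward arc closes the segment to a directed cycle, a forward one to a cycle with one
  arc to reverse. \<open>Suc a < b\<close> excludes the arcs of the path itself.\<close>

lemma cycle_set_chord:
  assumes "dipath E vs" "a < b" "b < length vs"
    and "(vs ! b, vs ! a) \<in> E \<or> Suc a < b \<and> (vs ! a, vs ! b) \<in> E"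
  obtains X where "cycle_set E X" "X \<subseteq> set vs" "card X = Suc b - a"
proof -
  obtain ws where ws: "dipath E ws" "length ws = Suc b - a" "hd ws = vs ! a" "last ws = vs ! b"
    "set ws \<subseteq> set vs"
    using dipath_segment[OF assms(1), of a b] assms by auto
  have nd: "near_directed_list E ws"
    using ws assms by (auto simp: near_directed_list_def)
  show ?thesis
    by (rule that[of "set ws"])
      (use nd ws assms card_cycle_set[OF nd] in \<open>auto simp: cycle_set_def\<close>)
qed

text \<open>Out-neighbours at positions \<open>a < b < c\<close> yield two cycles whose lengths add
  up to \<open>c - a + 4\<close>, at most \<open>length vs + 3\<close>. If neither were shorter than
  \<open>vs\<close>, then \<open>length vs \<le> 3\<close>.\<close>

lemma shorter_cycle_set:
  assumes "near_directed_list E vs" "4 \<le> length vs" "v \<notin> set vs" "3 \<le> card (E `` {v} \<inter> set vs)"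
  obtains X where "cycle_set E X" "X \<subseteq> insert v (set vs)" "card X < length vs"
proof -
  have dp: "dipath E vs" using assms by (simp add: near_directed_list_def)
  let ?I = "{i. i < length vs \<and> (v, vs ! i) \<in> E}"
  have "E `` {v} \<inter> set vs = (!) vs ` ?I" by (auto simp: set_conv_nth)
  moreover have "card ((!) vs ` ?I) \<le> card ?I" by (rule card_image_le) simp
  ultimately have "3 \<le> card ?I" using assms by simp
  then obtain J where J: "J \<subseteq> ?I" "card J = 3" by (meson obtain_subset_with_card_n)
  then obtain a b c where abc: "a < b" "b < c" "J = {a, b, c}"
  proof -
    obtain x y z where J3: "J = {x, y, z}" "x \<noteq> y" "x \<noteq> z" "y \<noteq> z"
      using J(2) by (auto simp: card_3_iff)
    then consider "x < y \<and> y < z" | "x < z \<and> z < y" | "y < x \<and> x < z" | "y < z \<and> z < x"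
      | "z < x \<and> x < y" | "z < y \<and> y < x" by linarith
    then show thesis using J3 that by cases (auto intro: that)
  qed
  have I: "a \<in> ?I" "b \<in> ?I" "c \<in> ?I" using J abc by auto
  have "b - a + 2 < length vs \<or> c - b + 2 < length vs"
    using I abc assms(2) by auto
  then show thesis
  proof
    assume s: "b - a + 2 < length vs"
    show thesis
      by (rule cycle_set_of_two_out_neighbours[OF dp assms(3) abc(1)]) (use I s that in auto)
  next
    assume s: "c - b + 2 < length vs"
    show thesis
      by (rule cycle_set_of_two_out_neighbours[OF dp assms(3) abc(2)]) (use I s that in auto)
  qed
qed

text \<open>At most one of the six possible incidences is missing. If \<open>B\<close> misses some
  \<open>x\<close> in \<open>T\<close>, then \<open>A\<close> contains all of \<open>T\<close>;
  otherwise any element of \<open>A \<inter> T\<close> serves.\<close>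

lemma three_set_split:
  assumes "card T = 3" "5 \<le> card (A \<inter> T) + card (B \<inter> T)"
  obtains x where "x \<in> T" "x \<in> A" "T - {x} \<subseteq> B"
proof -
  have fT: "finite T" using assms(1) card.infinite by force
  have le: "card (A \<inter> T) \<le> 3" "card (B \<inter> T) \<le> 3"
    using card_mono[OF fT, of "A \<inter> T"] card_mono[OF fT, of "B \<inter> T"] assms(1) by auto
  show thesis
  proof (cases "T \<subseteq> B")
    case True
    have "A \<inter> T \<noteq> {}" using assms(2) le by auto
    then show thesis using that True by blast
  next
    case False
    then obtain x where x: "x \<in> T" "x \<notin> B" by auto
    have c2: "card (T - {x}) = 2" using x fT assms(1) by simp
    have "B \<inter> T \<subseteq> T - {x}" using x by auto
    then have "card (B \<inter> T) \<le> 2" using card_mono[of "T - {x}" "B \<inter> T"] fT c2 by simp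
    then have "card (A \<inter> T) = 3" "card (B \<inter> T) = 2" using assms(2) le by linarith+
    then have "A \<inter> T = T" "B \<inter> T = T - {x}"
      using assms(1) fT c2 \<open>B \<inter> T \<subseteq> T - {x}\<close>
      by (metis card_subset_eq Int_lower2, metis card_subset_eq finite_Diff)
    then show thesis using that x by blast
  qed
qed

section \<open>Oriented graphs\<close>

locale oriented_graph =
  fixes V :: "'a set" and E :: "('a \<times> 'a) set"
  assumes finite_V: "finite V"
    and arcs_in_V: "E \<subseteq> V \<times> V"
    and asymmetric: "(u, v) \<in> E \<Longrightarrow> (v, u) \<notin> E"
begin

lemma irreflexive: "(v, v) \<notin> E"
  using asymmetric by blast

text \<open>The bound 3 comes from asymmetry: a near-directed list of length 2 would be a
  digon.\<close>

lemma cycle_setD: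
  assumes "cycle_set E X"
  obtains vs where "dipath E vs" "3 \<le> length vs" "set vs = X" "length vs = card X"
    "near_directed_list E vs"
proof -
  obtain vs where vs: "near_directed_list E vs" "set vs = X" using assms by (auto simp: cycle_set_def)
  have "3 \<le> length vs"
  proof (rule ccontr)
    assume "\<not> ?thesis"
    then have l: "length vs = 2" using vs by (auto simp: near_directed_list_def)
    then have "(vs ! 0, vs ! 1) \<in> E" "(vs ! 1, vs ! 0) \<in> E"
      using vs by (auto simp: near_directed_list_def dipath_conv_nth hd_conv_nth last_conv_nth
          simp flip: length_greater_0_conv)
    then show False using asymmetric by blast
  qed
  with vs that card_cycle_set[OF vs(1)] show thesis by (auto simp: near_directed_list_def)
qed

lemma cycle_set_card_ge: "cycle_set E X \<Longrightarrow> 3 \<le> card X"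
  by (metis cycle_setD)

lemma cycle_set_subset:
  assumes "cycle_set E X"
  shows "X \<subseteq> V"
proof
  fix x assume "x \<in> X"
  obtain vs where vs: "dipath E vs" "3 \<le> length vs" "set vs = X" using assms by (metis cycle_setD)
  obtain i where i: "i < length vs" "x = vs ! i" using \<open>x \<in> X\<close> vs by (metis in_set_conv_nth)
  show "x \<in> V"
  proof (cases "Suc i < length vs")
    case True
    then show ?thesis using vs i arcs_in_V by (auto simp: dipath_conv_nth)
  next
    case False
    then obtain j where "i = Suc j" using i vs by (cases i) auto
    then show ?thesis using vs i arcs_in_V by (auto simp: dipath_conv_nth)
  qed
qed

lemma finite_cycle_set: "cycle_set E X \<Longrightarrow> finite X"
  using cycle_set_subset finite_V finite_subset by blast

lemma triangle_adjacent:
  assumes "cycle_set E X" "card X = 3" "x \<in> X" "y \<in> X" "x \<noteq> y"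
  shows "(x, y) \<in> E \<or> (y, x) \<in> E"
proof -
  obtain vs where vs: "near_directed_list E vs" "set vs = X" "length vs = 3"
    using assms by (metis cycle_setD)
  then obtain a b c where abc: "vs = [a, b, c]" by (auto simp: numeral_3_eq_3 length_Suc_conv)
  have "(vs ! 0, vs ! Suc 0) \<in> E" "(vs ! Suc 0, vs ! Suc (Suc 0)) \<in> E"
    using vs by (auto simp: near_directed_list_def dipath_conv_nth)
  then show ?thesis using assms vs abc by (auto simp: near_directed_list_def)
qed

text \<open>The triangle is transitive with source \<open>u\<close>: start at \<open>u\<close> and
  follow the arc between the other two vertices.\<close>

lemma triangleI:
  assumes "(u, v) \<in> E" "(u, w) \<in> E" "(v, w) \<in> E \<or> (w, v) \<in> E"
  shows "cycle_set E {u, v, w}" "card {u, v, w} = 3"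
proof -
  have *: "cycle_set E {u, v, w}" if "(u, v) \<in> E" "(u, w) \<in> E" "(v, w) \<in> E" for v w
  proof -
    have "distinct [u, v, w]" using that irreflexive by auto
    then have "near_directed_list E [u, v, w]"
      using that by (auto simp: near_directed_list_def dipath_conv_nth less_Suc_eq numeral_3_eq_3)
    then show ?thesis by (auto simp: cycle_set_def intro!: exI[of _ "[u, v, w]"])
  qed
  show "cycle_set E {u, v, w}"
    using assms *[of v w] *[of w v] by (auto simp: insert_commute)
  show "card {u, v, w} = 3"
    using assms irreflexive by (metis card_3_iff)
qed

section \<open>Two disjoint triangles on seven vertices\<close>

text \<open>\<open>u2\<close> and \<open>w2\<close> share two out-neighbours in \<open>T\<close>. If
  \<open>u1\<close> and \<open>w1\<close> share one as well, the two arcs get different apexes.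
  Otherwise \<open>u1\<close> and \<open>w1\<close> send only three arcs, so \<open>u2\<close> and
  \<open>w2\<close> dominate \<open>T\<close>: one of \<open>u1\<close>, \<open>w1\<close> forms a
  triangle with two vertices of \<open>T\<close>, and the third is an apex for the other
  arc.\<close>

lemma two_triangles_if_five:
  assumes arcs: "(u1, w1) \<in> E" "(u2, w2) \<in> E" and dist: "distinct [u1, w1, u2, w2]"
    and T: "cycle_set E T" "card T = 3" "T \<inter> {u1, w1, u2, w2} = {}"
    and nine: "9 \<le> card (E `` {u1} \<inter> T) + card (E `` {w1} \<inter> T)
        + card (E `` {u2} \<inter> T) + card (E `` {w2} \<inter> T)"
    and five: "5 \<le> card (E `` {u2} \<inter> T) + card (E `` {w2} \<inter> T)"
  obtains X Y where "cycle_set E X" "cycle_set E Y" "card X = 3" "card Y = 3" "X \<inter> Y = {}"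
    "X \<union> Y \<subseteq> T \<union> {u1, w1, u2, w2}"
proof -
  let ?N = "\<lambda>v. E `` {v} \<inter> T"
  have fT: "finite T" using T finite_cycle_set by blast
  have le: "card (?N v) \<le> 3" for v using T(2) card_mono[OF fT, of "?N v"] by auto
  have un: "card (?N v \<union> ?N w) \<le> 3" for v w
    using T(2) card_mono[OF fT, of "?N v \<union> ?N w"] by auto
  have sum: "card (?N v) + card (?N w) = card (?N v \<union> ?N w) + card (?N v \<inter> ?N w)" for v w
    using fT by (intro card_Un_Int) auto
  have two: "2 \<le> card (?N u2 \<inter> ?N w2)" using five sum[of u2 w2] un[of u2 w2] by linarith
  show thesis
  proof (cases "?N u1 \<inter> ?N w1 = {}")
    case False
    then obtain x where x: "x \<in> T" "(u1, x) \<in> E" "(w1, x) \<in> E" by auto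
    have "\<not> ?N u2 \<inter> ?N w2 \<subseteq> {x}" using two card_mono[of "{x}" "?N u2 \<inter> ?N w2"] by auto
    then obtain y where y: "y \<in> T" "(u2, y) \<in> E" "(w2, y) \<in> E" "y \<noteq> x" by auto
    show thesis
      by (rule that[of "{u1, w1, x}" "{u2, w2, y}"])
        (use x y arcs dist T(3) triangleI[of u1 w1 x] triangleI[of u2 w2 y] in auto)
  next
    case True
    then have "card (?N u1) + card (?N w1) \<le> 3" using sum[of u1 w1] un[of u1 w1] by simp
    then have "card (?N u1) + card (?N w1) = 3" "card (?N u2) + card (?N w2) = 6"
      using nine le[of u2] le[of w2] by linarith+
    then have six: "card (?N u2) = 3" "card (?N w2) = 3" using le[of u2] le[of w2] by linarith+
    have all: "?N u2 = T" "?N w2 = T"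
      by (rule card_subset_eq; use six T(2) fT in simp)+
    have "2 \<le> card (?N u1) \<or> 2 \<le> card (?N w1)"
      using \<open>card (?N u1) + card (?N w1) = 3\<close> by linarith
    then obtain v where v: "v \<in> {u1, w1}" "2 \<le> card (?N v)" by auto
    obtain B where B: "B \<subseteq> ?N v" "card B = 2" using v(2) by (meson obtain_subset_with_card_n)
    then obtain a b where ab: "B = {a, b}" "a \<noteq> b" by (auto simp: card_2_iff)
    have "\<not> T \<subseteq> {a, b}" using T(2) card_mono[of "{a, b}" T] ab by auto
    then obtain c where c: "c \<in> T" "c \<noteq> a" "c \<noteq> b" by auto
    have adj: "(a, b) \<in> E \<or> (b, a) \<in> E" using triangle_adjacent[OF T(1,2)] ab B by auto
    have "c \<in> ?N u2" "c \<in> ?N w2" using all c by auto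
    then show thesis
      by (intro that[of "{v, a, b}" "{u2, w2, c}"])
        (use v B ab c adj arcs dist T(3) triangleI[of v a b] triangleI[of u2 w2 c] in auto)
  qed
qed

text \<open>One of the two pairs sends at least five of the nine arcs, and the pairs play symmetric
  roles.\<close>

lemma two_triangles:
  assumes arcs: "(u1, w1) \<in> E" "(u2, w2) \<in> E" and dist: "distinct [u1, w1, u2, w2]"
    and T: "cycle_set E T" "card T = 3" "T \<inter> {u1, w1, u2, w2} = {}"
    and nine: "9 \<le> card (E `` {u1} \<inter> T) + card (E `` {w1} \<inter> T)
        + card (E `` {u2} \<inter> T) + card (E `` {w2} \<inter> T)"
  obtains X Y where "cycle_set E X" "cycle_set E Y" "card X = 3" "card Y = 3" "X \<inter> Y = {}"
    "X \<union> Y \<subseteq> T \<union> {u1, w1, u2, w2}"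
proof (cases "5 \<le> card (E `` {u2} \<inter> T) + card (E `` {w2} \<inter> T)")
  case True
  show thesis by (rule two_triangles_if_five[OF arcs dist T nine True]) (rule that)
next
  case False
  then have five: "5 \<le> card (E `` {u1} \<inter> T) + card (E `` {w1} \<inter> T)" using nine by linarith
  have sym: "{u2, w2, u1, w1} = {u1, w1, u2, w2}" by auto
  show thesis
    by (rule two_triangles_if_five[OF arcs(2,1) _ T(1,2) _ _ five, unfolded sym])
      (use dist T(3) nine in \<open>auto simp: add_ac intro: that\<close>)
qed

text \<open>\<open>E\<close> and its converse are disjoint sets of pairs of distinct vertices, so
  \<open>2 * d * card V \<le> card V * (card V - 1)\<close>.\<close>

lemma card_ge_out_degree:
  assumes "V \<noteq> {}" "\<And>v. v \<in> V \<Longrightarrow> d \<le> card (E `` {v})"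
  shows "2 * d + 1 \<le> card V"
proof -
  have fE: "finite E" using arcs_in_V finite_V finite_subset by blast
  have "card V * d \<le> (\<Sum>v\<in>V. card (E `` {v}))"
    using sum_bounded_below[of V d "\<lambda>v. card (E `` {v})"] assms by simp
  also have "\<dots> = card (SIGMA v:V. E `` {v})"
    using finite_V fE by (subst card_SigmaI) auto
  also have "(SIGMA v:V. E `` {v}) = E" using arcs_in_V by auto
  finally have 1: "card V * d \<le> card E" .
  have "card E + card (E\<inverse>) = card (E \<union> E\<inverse>)"
    using fE asymmetric by (intro card_Un_disjoint[symmetric]) auto
  also have "\<dots> \<le> card (V \<times> V - Id_on V)"
    using finite_V arcs_in_V irreflexive by (intro card_mono) auto
  also have "\<dots> = card V * card V - card V"
  proof -
    have "card (Id_on V) = card V"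
      by (rule bij_betw_same_card[of fst]) (auto simp: bij_betw_def inj_on_def Id_on_def image_iff)
    then show ?thesis using finite_V by (subst card_Diff_subset) (auto simp: card_cartesian_product Id_on_def)
  qed
  finally have "2 * (card V * d) \<le> card V * card V - card V"
    using 1 by (simp add: card_inverse)
  then have "card V * (2 * d) \<le> card V * (card V - 1)" by (simp add: algebra_simps diff_mult_distrib2)
  moreover have "0 < card V" using assms(1) finite_V by (simp add: card_gt_0_iff)
  ultimately have "2 * d \<le> card V - 1" by simp
  then show ?thesis using \<open>0 < card V\<close> by linarith
qed

definition packing :: "'a set set \<Rightarrow> bool" where
  "packing F \<longleftrightarrow> (\<forall>X\<in>F. cycle_set E X) \<and> disjoint F"

text \<open>
  One cycle outweighs any two strictly longer ones; this is all that the base 3 is needed for.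
\<close>
definition weight :: "'a set set \<Rightarrow> nat" where
  "weight F = (\<Sum>X\<in>F. 3 ^ (card V - card X))"

lemma packing_subset_Pow: "packing F \<Longrightarrow> F \<subseteq> Pow V"
  using cycle_set_subset by (auto simp: packing_def)

lemma finite_packing: "packing F \<Longrightarrow> finite F"
  using packing_subset_Pow finite_V finite_subset by blast

end

section \<open>Optimal packings\<close>

text \<open>The path competes with paths outside every packing of equal weight, not only outside
  \<open>F\<close>. Hence a swap of triangles that lengthens the path is contradictory too.\<close>

locale optimal_packing = oriented_graph +
  fixes F :: "'a set set" and P :: "'a list"
  assumes packing: "packing F"
    and weight_max: "packing G \<Longrightarrow> weight G \<le> weight F"
    and path: "dipath E P" "set P \<subseteq> V - \<Union>F"
    and path_max: "\<lbrakk>packing G; weight G = weight F; dipath E Q; set Q \<subseteq> V - \<Union>G\<rbrakk>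
      \<Longrightarrow> length Q \<le> length P"
begin

definition rest :: "'a set" where "rest = V - \<Union>F"
definition triangles :: "'a set set" where "triangles = {X \<in> F. card X = 3}"
definition long :: "'a set set" where "long = {X \<in> F. 4 \<le> card X}"
definition tri_degree :: "'a \<Rightarrow> nat" where
  "tri_degree v = (\<Sum>T\<in>triangles. card (E `` {v} \<inter> T))"

lemma finite_F: "finite F"
  using packing finite_packing by blast

lemma finite_rest: "finite rest"
  using finite_V by (simp add: rest_def)

lemma cycle_in_F: "X \<in> F \<Longrightarrow> cycle_set E X"
  using packing by (simp add: packing_def)

lemma disjoint_in_F: "X \<in> F \<Longrightarrow> Y \<in> F \<Longrightarrow> X \<noteq> Y \<Longrightarrow> X \<inter> Y = {}"
  using packing by (auto simp: packing_def disjoint_def)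

lemma cycle_le_card_V: "cycle_set E X \<Longrightarrow> card X \<le> card V"
  using cycle_set_subset finite_V card_mono by blast

lemma F_split: "F = triangles \<union> long" "triangles \<inter> long = {}" "finite triangles" "finite long"
  using cycle_in_F cycle_set_card_ge finite_F
  by (force simp: triangles_def long_def)+

text \<open>\<open>B\<close> uses only vertices released by \<open>A\<close> or uncovered, so it
  avoids the cycles that are kept. The weights are compared additively to avoid truncated
  subtraction.\<close>

lemma exchange:
  assumes "A \<subseteq> F" "packing B" "\<Union>B \<subseteq> \<Union>A \<union> rest"
  shows "packing (F - A \<union> B)" "weight (F - A \<union> B) + weight A = weight F + weight B"
proof -
  have dj: "X \<inter> Y = {}" if "X \<in> F - A" "Y \<in> B" for X Y
  proof -
    have "X \<inter> \<Union>A = {}" using that assms(1) disjoint_in_F by blast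
    moreover have "X \<inter> rest = {}" using that by (auto simp: rest_def)
    ultimately show ?thesis using that assms(3) by blast
  qed
  show "packing (F - A \<union> B)"
    unfolding packing_def disjoint_def
  proof (intro conjI ballI impI)
    show "cycle_set E X" if "X \<in> F - A \<union> B" for X
      using that assms(2) cycle_in_F by (auto simp: packing_def)
    show "X \<inter> Y = {}" if "X \<in> F - A \<union> B" "Y \<in> F - A \<union> B" "X \<noteq> Y" for X Y
      using that dj[of X Y] dj[of Y X] disjoint_in_F[of X Y] assms(2)
      by (auto simp: packing_def disjoint_def)
  qed
  \<comment> \<open>A common member would be disjoint from itself, hence empty; cycles are
    not.\<close>
  have "(F - A) \<inter> B = {}"
  proof (rule ccontr)
    assume "\<not> ?thesis"
    then obtain X where "X \<in> F - A" "X \<in> B" by blast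
    then have "X \<inter> X = {}" by (rule dj)
    moreover have "3 \<le> card X" using \<open>X \<in> F - A\<close> cycle_in_F cycle_set_card_ge by blast
    ultimately show False by simp
  qed
  then have "weight (F - A \<union> B) = weight (F - A) + weight B"
    using finite_F finite_packing[OF assms(2)] by (simp add: weight_def sum.union_disjoint)
  moreover have "weight F = weight (F - A) + weight A"
    using assms(1) finite_F by (simp add: weight_def sum.subset_diff)
  ultimately show "weight (F - A \<union> B) + weight A = weight F + weight B" by simp
qed

lemma weight_le:
  assumes "A \<subseteq> F" "packing B" "\<Union>B \<subseteq> \<Union>A \<union> rest"
  shows "weight B \<le> weight A"
  using exchange[OF assms] weight_max[of "F - A \<union> B"] by linarith

lemma no_cycle_in_rest:
  assumes "cycle_set E X"
  shows "\<not> X \<subseteq> rest"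
  using weight_le[of "{}" "{X}"] assms by (auto simp: packing_def weight_def)

lemma no_shorter_cycle:
  assumes "C \<in> F" "cycle_set E X" "X \<subseteq> C \<union> rest"
  shows "card C \<le> card X"
proof -
  have "(3::nat) ^ (card V - card X) \<le> 3 ^ (card V - card C)"
    using weight_le[of "{C}" "{X}"] assms by (auto simp: packing_def weight_def)
  then have "card V - card X \<le> card V - card C" by (simp add: power_increasing_iff)
  then show ?thesis
    using cycle_le_card_V[OF assms(2)] cycle_le_card_V[OF cycle_in_F[OF assms(1)]] by linarith
qed

text \<open>Two cycles are given up for one: in base 3, a cycle shorter than both outweighs them
  together.\<close>

lemma no_shorter_cycle_two:
  assumes "C \<in> F" "D \<in> F" "C \<noteq> D" "card D \<le> card C" "cycle_set E X" "X \<subseteq> C \<union> D \<union> rest"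
  shows "card D \<le> card X"
proof (rule ccontr)
  assume less: "\<not> ?thesis"
  let ?n = "card V"
  have "(3::nat) ^ (?n - card X) \<le> 3 ^ (?n - card C) + 3 ^ (?n - card D)"
    using weight_le[of "{C, D}" "{X}"] assms by (auto simp: packing_def weight_def)
  also have "\<dots> \<le> 2 * 3 ^ (?n - card D)"
    using assms(4) power_increasing[of "?n - card C" "?n - card D" "3::nat"] by simp
  also have "\<dots> < 3 ^ Suc (?n - card D)" by simp
  also have "\<dots> \<le> 3 ^ (?n - card X)"
    using less cycle_le_card_V[OF cycle_in_F[OF assms(2)]] by (intro power_increasing) auto
  finally show False by simp
qed

text \<open>The new triangles weigh \<open>2 * 3 ^ (card V - 3)\<close>, while \<open>A\<close> has
  one triangle and at most one strictly lighter cycle.\<close>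

lemma no_two_triangles:
  assumes "A \<subseteq> F" "A = {T} \<or> A = {T, C} \<and> C \<in> long" "card T = 3"
    and "cycle_set E X" "cycle_set E Y" "card X = 3" "card Y = 3" "X \<inter> Y = {}"
  shows "\<not> X \<union> Y \<subseteq> \<Union>A \<union> rest"
proof
  assume sub: "X \<union> Y \<subseteq> \<Union>A \<union> rest"
  let ?n = "card V"
  have ne: "X \<noteq> Y" using assms(6,8) by auto
  have "packing {X, Y}" using assms(4,5,8) by (auto simp: packing_def disjoint_def)
  then have "weight {X, Y} \<le> weight A" using assms(1) sub by (intro weight_le) auto
  then have le: "2 * 3 ^ (?n - 3) \<le> weight A" using ne assms(6,7) by (simp add: weight_def)
  have "weight A < 2 * 3 ^ (?n - 3)"
    using assms(2)
  proof
    assume A: "A = {T, C} \<and> C \<in> long"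
    then have C: "C \<in> F" "4 \<le> card C" by (auto simp: long_def)
    then have "?n - card C < ?n - 3" using cycle_le_card_V[OF cycle_in_F[of C]] by linarith
    then have "(3::nat) ^ (?n - card C) < 3 ^ (?n - 3)" by (rule power_strict_increasing) simp
    moreover have "T \<noteq> C" using C assms(3) by auto
    ultimately show ?thesis using A assms(3) by (simp add: weight_def)
  next
    assume "A = {T}"
    then show ?thesis using assms(3) by (simp add: weight_def)
  qed
  with le show False by simp
qed

section \<open>Directed paths in the uncovered set\<close>

text \<open>Any other arc between vertices of the path would close a near-directed cycle inside
  \<open>rest\<close>, which could be added to \<open>F\<close>.\<close>

lemma path_arc_in_rest:
  assumes "dipath E Q" "set Q \<subseteq> rest" "a < length Q" "b < length Q" "(Q ! a, Q ! b) \<in> E"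
  shows "b = Suc a"
proof (rule ccontr)
  assume ne: "b \<noteq> Suc a"
  have "a \<noteq> b" using assms(5) irreflexive by auto
  then consider "a < b" "Suc a < b" | "b < a" using ne by linarith
  then obtain X where "cycle_set E X" "X \<subseteq> set Q"
  proof cases
    case 1
    then show thesis using cycle_set_chord[OF assms(1) 1(1) assms(4)] assms(5) that by metis
  next
    case 2
    then show thesis using cycle_set_chord[OF assms(1) 2 assms(3)] assms(5) that by metis
  qed
  then show False using no_cycle_in_rest assms(2) by blast
qed

lemma longest_path_ends_in_sink:
  assumes "dipath E Q" "set Q \<subseteq> W" "Q \<noteq> []" "W \<subseteq> rest"
    and longest: "\<And>Q'. \<lbrakk>dipath E Q'; set Q' \<subseteq> W; Q' \<noteq> []\<rbrakk> \<Longrightarrow> length Q' \<le> length Q"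
  shows "E `` {last Q} \<inter> W = {}"
proof -
  have "u \<notin> W" if "(last Q, u) \<in> E" for u
  proof
    assume "u \<in> W"
    show False
    proof (cases "u \<in> set Q")
      case True
      then obtain b where b: "b < length Q" "u = Q ! b" by (metis in_set_conv_nth)
      \<comment> \<open>An out-neighbour on the path would have to follow the last vertex.\<close>
      then have "b = Suc (length Q - 1)"
        using path_arc_in_rest[of Q "length Q - 1" b] assms that
        by (auto simp: last_conv_nth)
      then show False using b by simp
    next
      case False
      then have "dipath E (Q @ [u])" using dipath_snoc[of E Q u] assms(1) that by simp
      then show False using longest[of "Q @ [u]"] assms(2) \<open>u \<in> W\<close> by simp
    qed
  qed
  then show ?thesis by auto
qed

lemma exists_sink:
  assumes "W \<subseteq> rest" "W \<noteq> {}"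
  obtains v where "v \<in> W" "E `` {v} \<inter> W = {}"
proof -
  let ?Q = "\<lambda>Q. dipath E Q \<and> set Q \<subseteq> W \<and> Q \<noteq> []"
  obtain w where "w \<in> W" using assms(2) by auto
  then have "?Q [w]" by (simp add: dipath_def)
  moreover have "length Q \<le> card W" if "?Q Q" for Q
    using that finite_subset[OF assms(1) finite_rest] card_mono[of W "set Q"]
    by (simp add: dipath_def distinct_card)
  ultimately obtain Q where Q: "?Q Q" "\<And>Q'. ?Q Q' \<Longrightarrow> length Q' \<le> length Q"
    using ex_has_greatest_nat[of ?Q "[w]" length "Suc (card W)"] by (auto simp: less_Suc_eq_le)
  have "E `` {last Q} \<inter> W = {}"
    by (rule longest_path_ends_in_sink) (use Q assms(1) in auto)
  then show thesis using that[of "last Q"] Q(1) last_in_set by blast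
qed

section \<open>Counting arcs into the cycles of the packing\<close>

lemma out_degree_split:
  assumes "v \<in> V"
  shows "card (E `` {v}) =
    tri_degree v + (\<Sum>X\<in>long. card (E `` {v} \<inter> X)) + card (E `` {v} \<inter> rest)"
proof -
  let ?N = "E `` {v}"
  have N: "?N \<subseteq> V" using arcs_in_V by auto
  then have fN: "finite ?N" using finite_V finite_subset by blast
  have "?N = (\<Union>X\<in>F. ?N \<inter> X) \<union> (?N \<inter> rest)" using N by (auto simp: rest_def)
  also have "card \<dots> = card (\<Union>X\<in>F. ?N \<inter> X) + card (?N \<inter> rest)"
    using fN finite_F by (intro card_Un_disjoint) (auto simp: rest_def)
  also have "card (\<Union>X\<in>F. ?N \<inter> X) = (\<Sum>X\<in>F. card (?N \<inter> X))"
    using finite_F fN disjoint_in_F by (intro card_UN_disjoint) blast+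
  also have "\<dots> = tri_degree v + (\<Sum>X\<in>long. card (?N \<inter> X))"
    unfolding tri_degree_def
    by (subst F_split(1), rule sum.union_disjoint) (simp_all add: F_split(2-4))
  finally show ?thesis .
qed

lemma rest_to_long:
  assumes "v \<in> rest" "X \<in> long"
  shows "card (E `` {v} \<inter> X) \<le> 2"
proof (rule ccontr)
  assume gt: "\<not> ?thesis"
  have X: "X \<in> F" "4 \<le> card X" using assms by (auto simp: long_def)
  obtain vs where vs: "near_directed_list E vs" "set vs = X" "length vs = card X"
    using cycle_in_F[OF X(1)] by (metis cycle_setD)
  have "v \<notin> X" using assms X by (auto simp: rest_def)
  then obtain Y where "cycle_set E Y" "Y \<subseteq> insert v X" "card Y < card X"
    using shorter_cycle_set[OF vs(1), of v] gt vs X by auto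
  then show False using no_shorter_cycle[OF X(1), of Y] assms by auto
qed

text \<open>The shorter cycle found uses a vertex of \<open>C\<close>, so both \<open>C\<close> and
  \<open>X\<close> must be given up; this is why \<open>X\<close> may not be longer than
  \<open>C\<close>.\<close>

lemma long_to_long:
  assumes "C \<in> long" "X \<in> long" "X \<noteq> C" "card X \<le> card C" "v \<in> C"
  shows "card (E `` {v} \<inter> X) \<le> 2"
proof (rule ccontr)
  assume gt: "\<not> ?thesis"
  have X: "X \<in> F" "4 \<le> card X" "C \<in> F" using assms by (auto simp: long_def)
  obtain vs where vs: "near_directed_list E vs" "set vs = X" "length vs = card X"
    using cycle_in_F[OF X(1)] by (metis cycle_setD)
  have "v \<notin> X" using assms X disjoint_in_F by blast
  then obtain Y where "cycle_set E Y" "Y \<subseteq> insert v X" "card Y < card X"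
    using shorter_cycle_set[OF vs(1), of v] gt vs X by auto
  then show False using no_shorter_cycle_two[OF X(3,1), of Y] assms by auto
qed

text \<open>Average over the triangles after swapping the double sum.\<close>

lemma tri_degree_pigeonhole:
  assumes "finite S" "q * card triangles < (\<Sum>v\<in>S. tri_degree v)"
  obtains T where "T \<in> triangles" "q < (\<Sum>v\<in>S. card (E `` {v} \<inter> T))"
proof -
  have "(\<Sum>v\<in>S. tri_degree v) = (\<Sum>T\<in>triangles. \<Sum>v\<in>S. card (E `` {v} \<inter> T))"
    unfolding tri_degree_def by (rule sum.swap)
  then have "\<not> (\<forall>T\<in>triangles. (\<Sum>v\<in>S. card (E `` {v} \<inter> T)) \<le> q)"
    using assms(2) sum_bounded_above[of triangles "\<lambda>T. \<Sum>v\<in>S. card (E `` {v} \<inter> T)" q]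
    by (auto simp: mult.commute)
  then show thesis using that by force
qed

text \<open>A larger sum would send nine arcs to one triangle, and \<open>two_triangles\<close>
  would improve the packing. \<open>A\<close> is empty for vertices of the path and
  \<open>{C}\<close> for vertices of a long cycle.\<close>

lemma four_vertices:
  assumes "distinct [u1, w1, u2, w2]" "(u1, w1) \<in> E" "(u2, w2) \<in> E"
    and "{u1, w1, u2, w2} \<subseteq> \<Union>A \<union> rest" "A = {} \<or> A = {C} \<and> C \<in> long"
  shows "tri_degree u1 + tri_degree w1 + tri_degree u2 + tri_degree w2 \<le> 8 * card triangles"
proof (rule ccontr)
  assume gt: "\<not> ?thesis"
  have sum4: "sum f {u1, w1, u2, w2} = f u1 + f w1 + f u2 + f w2" for f :: "'a \<Rightarrow> nat"
    using assms(1) by auto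
  obtain T where T: "T \<in> triangles" "8 < (\<Sum>v\<in>{u1, w1, u2, w2}. card (E `` {v} \<inter> T))"
    using tri_degree_pigeonhole[of "{u1, w1, u2, w2}" 8] gt unfolding sum4
    by (metis finite.emptyI finite.insertI linorder_not_le)
  have TF: "T \<in> F" "card T = 3" "cycle_set E T"
    using T(1) cycle_in_F by (auto simp: triangles_def)
  have "C \<in> F" "T \<noteq> C" if "C \<in> long" using that TF by (auto simp: long_def)
  then have "T \<inter> \<Union>A = {}" using assms(5) TF disjoint_in_F[of T C] by auto
  then have dj: "T \<inter> {u1, w1, u2, w2} = {}" using assms(4) TF by (auto simp: rest_def)
  have nine: "9 \<le> card (E `` {u1} \<inter> T) + card (E `` {w1} \<inter> T)
      + card (E `` {u2} \<inter> T) + card (E `` {w2} \<inter> T)"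
    using T(2) unfolding sum4 by simp
  obtain X Y where XY: "cycle_set E X" "cycle_set E Y" "card X = 3" "card Y = 3" "X \<inter> Y = {}"
    "X \<union> Y \<subseteq> T \<union> {u1, w1, u2, w2}"
    by (rule two_triangles[OF assms(2,3,1) TF(3,2) dj nine])
  have "insert T A \<subseteq> F" using assms(5) TF by (auto simp: long_def)
  moreover have "X \<union> Y \<subseteq> \<Union>(insert T A) \<union> rest" using XY(6) assms(4) by auto
  ultimately show False
    using no_two_triangles[OF _ _ TF(2) XY(1-5), of "insert T A" C] assms(5) by auto
qed

end

section \<open>Refuting an optimal packing with fewer than \<open>k\<close> cycles\<close>

locale small_optimal_packing = optimal_packing +
  fixes k :: nat
  assumes card_F: "card F < k"
    and out_degree: "v \<in> V \<Longrightarrow> 2 * k \<le> Suc (card (E `` {v}))"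
    and V_nonempty: "V \<noteq> {}"
begin

lemma card_triangles_long: "card triangles + card long < k"
  using card_F F_split by (metis card_Un_disjoint)

text \<open>At most two arcs go to each long cycle, and \<open>k\<close> is at least
  \<open>card triangles + card long + 1\<close>.\<close>

lemma tri_degree_rest:
  assumes "v \<in> rest"
  shows "2 * card triangles + 1 \<le> tri_degree v + card (E `` {v} \<inter> rest)"
proof -
  have v: "v \<in> V" using assms by (simp add: rest_def)
  have "(\<Sum>X\<in>long. card (E `` {v} \<inter> X)) \<le> card long * 2"
    using sum_bounded_above[of long "\<lambda>X. card (E `` {v} \<inter> X)" 2] rest_to_long[OF assms] by simp
  then show ?thesis
    using out_degree_split[OF v] out_degree[OF v] card_triangles_long by linarith
qed

lemma P_in_rest: "set P \<subseteq> rest" and dipath_P: "dipath E P"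
  using path by (auto simp: rest_def)

lemma P_covers_rest: "set P = rest"
proof (rule ccontr)
  assume "\<not> ?thesis"
  then have W: "rest - set P \<noteq> {}" using P_in_rest by auto
  \<comment> \<open>All out-neighbours of \<open>v\<close> in \<open>rest\<close> lie on
    \<open>P\<close>; two of them would close a cycle with \<open>v\<close> inside
    \<open>rest\<close>.\<close>
  then obtain v where v: "v \<in> rest - set P" "E `` {v} \<inter> (rest - set P) = {}"
    using exists_sink[of "rest - set P"] by auto
  have "P \<noteq> []"
  proof
    assume "P = []"
    moreover have "length [v] \<le> length P"
      using path_max[of F "[v]"] packing v(1) by (auto simp: rest_def dipath_def)
    ultimately show False by simp
  qed
  let ?w = "last P"
  have w: "?w \<in> rest" "?w \<in> set P" using P_in_rest \<open>P \<noteq> []\<close> by auto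
  have Nw: "E `` {?w} \<inter> rest = {}"
  proof (rule longest_path_ends_in_sink[OF dipath_P P_in_rest \<open>P \<noteq> []\<close>])
    show "length Q \<le> length P" if "dipath E Q" "set Q \<subseteq> rest" for Q
      using path_max[OF packing refl that(1)] that(2) by (simp add: rest_def)
  qed simp
  have "card (E `` {v} \<inter> rest) \<le> 1"
  proof (rule ccontr)
    assume "\<not> ?thesis"
    then obtain x y where xy: "x \<in> E `` {v} \<inter> rest" "y \<in> E `` {v} \<inter> rest" "x \<noteq> y"
      by (metis card_le_Suc0_iff_eq finite_Int finite_rest One_nat_def)
    then have "x \<in> set P" "y \<in> set P" using v(2) by auto
    then obtain a b where ab: "a < length P" "b < length P" "x = P ! a" "y = P ! b"
      by (metis in_set_conv_nth)
    have *: False if arcs: "a < b" "b < length P" "(v, P ! a) \<in> E" "(v, P ! b) \<in> E" for a b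
    proof -
      have "v \<notin> set P" using v(1) by simp
      then obtain X where "cycle_set E X" "X \<subseteq> insert v (set P)"
        by (rule cycle_set_of_two_out_neighbours[OF dipath_P _ arcs])
      then show False using no_cycle_in_rest[of X] v(1) P_in_rest by auto
    qed
    show False using *[of a b] *[of b a] ab xy by (metis linorder_neqE_nat IntE Image_singleton_iff)
  qed
  then have "2 * card triangles \<le> tri_degree v" using tri_degree_rest[of v] v(1) by simp
  moreover have "2 * card triangles + 1 \<le> tri_degree ?w" using tri_degree_rest[OF w(1)] Nw by simp
  moreover have "?w \<noteq> v" using w v by auto
  \<comment> \<open>The two triangle degrees add up to at least
    \<open>4 * card triangles + 1\<close>, so some triangle receives five arcs.\<close>
  ultimately have "4 * card triangles < (\<Sum>z\<in>{?w, v}. tri_degree z)" by simp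
  then obtain T where T: "T \<in> triangles" "4 < (\<Sum>z\<in>{?w, v}. card (E `` {z} \<inter> T))"
    using tri_degree_pigeonhole[of "{?w, v}" 4] by auto
  have TF: "T \<in> F" "card T = 3" "cycle_set E T"
    using T(1) cycle_in_F by (auto simp: triangles_def)
  have "5 \<le> card (E `` {?w} \<inter> T) + card (E `` {v} \<inter> T)" using T(2) \<open>?w \<noteq> v\<close> by simp
  then obtain x where x: "x \<in> T" "x \<in> E `` {?w}" "T - {x} \<subseteq> E `` {v}"
    by (rule three_set_split[OF TF(2)])
  have "card (T - {x}) = 2" using x TF finite_cycle_set by simp
  then obtain y z where yz: "T - {x} = {y, z}" "y \<noteq> z" by (auto simp: card_2_iff)
  have adj: "(y, z) \<in> E \<or> (z, y) \<in> E"
    using triangle_adjacent[OF TF(3,2)] yz by auto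
  have B: "cycle_set E {v, y, z}" "card {v, y, z} = 3"
    using triangleI[of v y z] x yz adj by auto
  have pB: "packing {{v, y, z}}" using B by (auto simp: packing_def)
  \<comment> \<open>One triangle replaces another, so the weight is unchanged, and the released
    \<open>x\<close> extends \<open>P\<close>.\<close>
  let ?G = "F - {T} \<union> {{v, y, z}}"
  have G: "packing ?G" "weight ?G + weight {T} = weight F + weight {{v, y, z}}"
    using exchange[of "{T}" "{{v, y, z}}", OF _ pB] TF(1) v(1) yz by auto
  then have wG: "weight ?G = weight F" using B TF by (simp add: weight_def)
  have xF: "x \<notin> \<Union>(F - {T})" using x TF disjoint_in_F by blast
  have xV: "x \<in> V" using x TF cycle_set_subset by blast
  have "x \<noteq> v" "x \<notin> set P" using x(1) v(1) P_in_rest TF(1) by (auto simp: rest_def)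
  moreover have "x \<noteq> y" "x \<noteq> z" "y \<in> T" "z \<in> T" using yz by auto
  ultimately have "set (P @ [x]) \<subseteq> V - \<Union>?G"
    using xF xV P_in_rest v(1) TF(1) by (auto simp: rest_def)
  moreover have "dipath E (P @ [x])" using dipath_snoc[OF dipath_P \<open>x \<notin> set P\<close>] x by auto
  ultimately have "length (P @ [x]) \<le> length P" using path_max[OF G(1) wG] by blast
  then show False by simp
qed

lemma P_out_neighbours:
  assumes "a < length P"
  shows "card (E `` {P ! a} \<inter> rest) \<le> of_bool (Suc a < length P)"
proof -
  have "E `` {P ! a} \<inter> rest \<subseteq> (!) P ` {b. b = Suc a \<and> b < length P}"
  proof
    fix u assume u: "u \<in> E `` {P ! a} \<inter> rest"
    then obtain b where b: "b < length P" "u = P ! b"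
      using P_covers_rest by (metis IntD2 in_set_conv_nth)
    then have "b = Suc a" using path_arc_in_rest[OF dipath_P P_in_rest assms, of b] u by auto
    then show "u \<in> (!) P ` {b. b = Suc a \<and> b < length P}" using b by blast
  qed
  also have "\<dots> = (if Suc a < length P then {P ! Suc a} else {})" by auto
  finally have "card (E `` {P ! a} \<inter> rest) \<le> card (if Suc a < length P then {P ! Suc a} else {})"
    by (intro card_mono) auto
  then show ?thesis by (simp split: if_splits)
qed

text \<open>Each of the last four vertices has triangle degree at least
  \<open>2 * card triangles\<close>, and the final one exceeds this by one, having no out-neighbour
  in \<open>rest\<close>. This contradicts \<open>four_vertices\<close>.\<close>

lemma length_P_le: "length P \<le> 3"
proof (rule ccontr)
  assume "\<not> ?thesis"
  then have "4 \<le> length P" by simp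
  then obtain m where m: "length P = m + 4" by (metis add.commute le_Suc_ex)
  have dist: "distinct P" using dipath_P by (simp add: dipath_def)
  have arc: "(P ! a, P ! Suc a) \<in> E" if "Suc a < length P" for a
    using that dipath_P by (simp add: dipath_conv_nth)
  have in_rest: "P ! a \<in> rest" if "a < length P" for a using that P_in_rest by auto
  have one: "card (E `` {P ! a} \<inter> rest) \<le> 1" if "a < length P" for a
    using P_out_neighbours[OF that] by (rule order_trans) simp
  have zero: "card (E `` {P ! (m + 3)} \<inter> rest) = 0"
    using P_out_neighbours[of "m + 3"] m by simp
  have deg: "2 * card triangles \<le> tri_degree (P ! a)" if "a < length P" for a
    using tri_degree_rest[OF in_rest[OF that]] one[OF that] by linarith
  have degs: "2 * card triangles + 1 \<le> tri_degree (P ! (m + 3))"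
    using tri_degree_rest[OF in_rest[of "m + 3"]] zero m by simp
  have "tri_degree (P ! m) + tri_degree (P ! Suc m) + tri_degree (P ! (m + 2))
      + tri_degree (P ! Suc (m + 2)) \<le> 8 * card triangles"
    using m dist arc[of m] arc[of "m + 2"] in_rest
    by (intro four_vertices[where A = "{}"]) (auto simp: nth_eq_iff_index_eq)
  moreover have "Suc (m + 2) = m + 3" by simp
  ultimately have "tri_degree (P ! m) + tri_degree (P ! Suc m) + tri_degree (P ! (m + 2))
      + tri_degree (P ! (m + 3)) \<le> 8 * card triangles" by metis
  then show False using degs deg[of m] deg[of "Suc m"] deg[of "m + 2"] m by linarith
qed

lemma card_rest_le: "card rest \<le> 3"
  using length_P_le card_length[of P] P_covers_rest by simp

text \<open>With triangles only, \<open>4 * k - 1 \<le> card V \<le> 3 * card triangles + 3\<close>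
  and \<open>card triangles < k\<close> leave no triangle at all. The end of \<open>P\<close> would
  then have out-degree zero.\<close>

lemma long_nonempty: "long \<noteq> {}"
proof
  assume "long = {}"
  then have F: "F = triangles" using F_split by simp
  have "V = \<Union>F \<union> rest" using cycle_in_F cycle_set_subset by (auto simp: rest_def)
  then have "card V \<le> card (\<Union>F) + card rest" by (metis card_Un_le)
  also have "card (\<Union>F) \<le> (\<Sum>X\<in>F. card X)" by (rule card_Union_le_sum_card)
  also have "\<dots> = 3 * card triangles" by (subst F) (simp add: triangles_def)
  finally have V: "card V \<le> 3 * card triangles + card rest" by simp
  have "2 * (2 * k - 1) + 1 \<le> card V"
    using out_degree by (intro card_ge_out_degree[OF V_nonempty]) (simp add: le_diff_conv)
  moreover have "card triangles < k" using card_triangles_long by simp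
  ultimately have t: "card triangles = 0" and r: "0 < card rest"
    using V card_rest_le by linarith+
  then have P: "P \<noteq> []" using P_covers_rest by auto
  then have "last P \<in> rest" using P_in_rest by auto
  moreover have "card (E `` {last P} \<inter> rest) = 0"
    using P_out_neighbours[of "length P - 1"] P by (simp add: last_conv_nth)
  moreover have "tri_degree (last P) = 0" using t F_split by (simp add: tri_degree_def)
  ultimately show False using tri_degree_rest[of "last P"] by simp
qed

text \<open>A chord would give a shorter cycle on the vertices of \<open>C\<close>. Only path arcs
  and an arc between the two ends, in either direction, remain.\<close>

lemma long_arc:
  assumes "C \<in> long" "near_directed_list E vs" "set vs = C"
    and "a < length vs" "b < length vs" "(vs ! a, vs ! b) \<in> E"
  shows "b = Suc a \<or> a = 0 \<and> b = length vs - 1 \<or> a = length vs - 1 \<and> b = 0"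
proof -
  have dp: "dipath E vs" and l: "card C = length vs"
    using assms card_cycle_set by (auto simp: near_directed_list_def)
  have shortest: "length vs \<le> card X" if "cycle_set E X" "X \<subseteq> set vs" for X
    using that no_shorter_cycle[of C X] assms l by (auto simp: long_def)
  have "a \<noteq> b" using assms irreflexive by auto
  then consider "b = Suc a" | "a < b" "Suc a < b" | "b < a" by linarith
  then show ?thesis
  proof cases
    case 2
    then have "length vs \<le> Suc b - a"
      by (metis cycle_set_chord[OF dp 2(1) assms(5)] assms(6) shortest)
    then show ?thesis using assms by auto
  next
    case 3
    then have "length vs \<le> Suc a - b"
      by (metis cycle_set_chord[OF dp 3 assms(4)] assms(6) shortest)
    then show ?thesis using assms by auto
  qed auto
qed

lemma contradiction: False
proof -
  have "Max (card ` long) \<in> card ` long" using long_nonempty F_split by (intro Max_in) auto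
  then obtain C where C: "C \<in> long" "card C = Max (card ` long)" by auto
  have largest: "card X \<le> card C" if "X \<in> long" for X
    using that C(2) F_split by simp
  have CF: "C \<in> F" "4 \<le> card C" using C by (auto simp: long_def)
  obtain vs where vs: "near_directed_list E vs" "set vs = C" "dipath E vs" "length vs = card C"
    using cycle_in_F[OF CF(1)] by (metis cycle_setD)
  let ?l = "length vs"
  have l: "4 \<le> ?l" using vs CF by simp
  have lt: "0 < ?l" "1 < ?l" "2 < ?l" "3 < ?l" using l by linarith+
  have dist: "distinct vs" using vs by (simp add: dipath_def)
  have inC: "vs ! a \<in> C" if "a < ?l" for a using that vs(2) by auto
  have arc: "(vs ! a, vs ! Suc a) \<in> E" if "Suc a < ?l" for a
    using that vs(3) by (simp add: dipath_conv_nth)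
  \<comment> \<open>The closing arc may point from position 0 to the last position, so position 0
    alone may have a second out-neighbour in \<open>C\<close>.\<close>
  have chord: "E `` {vs ! a} \<inter> C \<subseteq> {vs ! (Suc a mod ?l)} \<union> (if a = 0 then {vs ! (?l - 1)} else {})"
    if "a < ?l" for a
  proof
    fix u assume u: "u \<in> E `` {vs ! a} \<inter> C"
    then obtain b where b: "b < ?l" "u = vs ! b" using vs(2) by (metis IntD2 in_set_conv_nth)
    have "b = Suc a \<or> a = 0 \<and> b = ?l - 1 \<or> a = ?l - 1 \<and> b = 0"
      using long_arc[OF C(1) vs(1,2) that b(1)] u b by simp
    then show "u \<in> {vs ! (Suc a mod ?l)} \<union> (if a = 0 then {vs ! (?l - 1)} else {})"
      using b that by auto
  qed
  have in_C0: "card (E `` {vs ! 0} \<inter> C) \<le> 2"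
  proof -
    have "E `` {vs ! 0} \<inter> C \<subseteq> set [vs ! 1, vs ! (?l - 1)]"
      using chord[of 0, OF order.strict_trans2[OF _ l]] l
      by (simp add: insert_commute)
    then have "card (E `` {vs ! 0} \<inter> C) \<le> card (set [vs ! 1, vs ! (?l - 1)])"
      by (rule card_mono[OF finite_set])
    also have "\<dots> \<le> 2" using card_length[of "[vs ! 1, vs ! (?l - 1)]"] by simp
    finally show ?thesis .
  qed
  have in_C: "card (E `` {vs ! a} \<inter> C) \<le> 1" if "a < ?l" "a \<noteq> 0" for a
    using card_mono[OF _ chord[OF that(1)]] that(2) by simp
  have in_rest: "card (E `` {vs ! a} \<inter> rest) + card (E `` {vs ! Suc a} \<inter> rest) \<le> 3"
    if "Suc a < ?l" for a
  proof -
    \<comment> \<open>A common out-neighbour would form a triangle with the two consecutive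
      vertices, shorter than \<open>C\<close>.\<close>
    have "E `` {vs ! a} \<inter> rest \<inter> (E `` {vs ! Suc a} \<inter> rest) = {}"
    proof (rule ccontr)
      assume "\<not> ?thesis"
      then obtain p where p: "p \<in> rest" "(vs ! a, p) \<in> E" "(vs ! Suc a, p) \<in> E" by auto
      have "cycle_set E {vs ! a, vs ! Suc a, p}" "card {vs ! a, vs ! Suc a, p} = 3"
        using triangleI[of "vs ! a" "vs ! Suc a" p] arc[OF that] p by auto
      then show False
        using no_shorter_cycle[OF CF(1), of "{vs ! a, vs ! Suc a, p}"] p inC that CF(2) by auto
    qed
    then have "card (E `` {vs ! a} \<inter> rest) + card (E `` {vs ! Suc a} \<inter> rest)
        = card (E `` {vs ! a} \<inter> rest \<union> E `` {vs ! Suc a} \<inter> rest)"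
      using finite_rest by (intro card_Un_disjoint[symmetric]) auto
    also have "\<dots> \<le> card rest" using finite_rest by (intro card_mono) auto
    finally show ?thesis using card_rest_le by linarith
  qed
  \<comment> \<open>As \<open>C\<close> is a longest cycle, \<open>long_to_long\<close> bounds the
    arcs to each of the other \<open>card long - 1\<close> long cycles by two.\<close>
  have deg: "2 * card triangles + 3
      \<le> tri_degree (vs ! a) + card (E `` {vs ! a} \<inter> C) + card (E `` {vs ! a} \<inter> rest)"
    if "a < ?l" for a
  proof -
    have v: "vs ! a \<in> V" using inC[OF that] cycle_set_subset[OF cycle_in_F[OF CF(1)]] by auto
    have "(\<Sum>X\<in>long. card (E `` {vs ! a} \<inter> X))
        = card (E `` {vs ! a} \<inter> C) + (\<Sum>X\<in>long - {C}. card (E `` {vs ! a} \<inter> X))"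
      using C(1) F_split by (intro sum.remove) auto
    also have "(\<Sum>X\<in>long - {C}. card (E `` {vs ! a} \<inter> X)) \<le> card (long - {C}) * 2"
      using long_to_long[OF C(1) _ _ largest inC[OF that]]
        sum_bounded_above[of "long - {C}" "\<lambda>X. card (E `` {vs ! a} \<inter> X)" 2] by simp
    also have "card (long - {C}) = card long - 1" using C(1) F_split by simp
    finally have "(\<Sum>X\<in>long. card (E `` {vs ! a} \<inter> X))
        \<le> card (E `` {vs ! a} \<inter> C) + (card long - 1) * 2" by simp
    moreover have "0 < card long" using C(1) F_split by (auto simp: card_gt_0_iff)
    ultimately show ?thesis
      using out_degree_split[OF v] out_degree[OF v] card_triangles_long
      by (simp add: algebra_simps)
  qed
  have "tri_degree (vs ! 0) + tri_degree (vs ! 1) + tri_degree (vs ! 2) + tri_degree (vs ! 3)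
      \<le> 8 * card triangles"
  proof (rule four_vertices[where A = "{C}" and C = C])
    show "distinct [vs ! 0, vs ! 1, vs ! 2, vs ! 3]"
      and "{vs ! 0, vs ! 1, vs ! 2, vs ! 3} \<subseteq> \<Union>{C} \<union> rest"
      using inC lt by (simp_all add: nth_eq_iff_index_eq[OF dist])
    show "(vs ! 0, vs ! 1) \<in> E" "(vs ! 2, vs ! 3) \<in> E"
      using arc[of 0] arc[of 2] l by (simp_all add: eval_nat_numeral)
  qed (use C(1) in simp)
  moreover have "card (E `` {vs ! 0} \<inter> rest) + card (E `` {vs ! 1} \<inter> rest) \<le> 3"
    "card (E `` {vs ! 2} \<inter> rest) + card (E `` {vs ! 3} \<inter> rest) \<le> 3"
    using in_rest[of 0] in_rest[of 2] l by (simp_all add: eval_nat_numeral)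
  moreover have "card (E `` {vs ! 1} \<inter> C) \<le> 1" "card (E `` {vs ! 2} \<inter> C) \<le> 1"
    "card (E `` {vs ! 3} \<inter> C) \<le> 1"
    using in_C lt by simp_all
  \<comment> \<open>The four vertices need \<open>8 * card triangles + 12\<close> arcs, but have at
    most \<open>8 * card triangles\<close> to triangles, 5 inside \<open>C\<close> and 6 to
    \<open>rest\<close>.\<close>
  ultimately show False using deg[OF lt(1)] deg[OF lt(2)] deg[OF lt(3)] deg[OF lt(4)] in_C0
    by linarith
qed

end

section \<open>Existence of optimal packings\<close>

context oriented_graph
begin

lemma exists_optimal_packing: "\<exists>F P. optimal_packing V E F P"
proof -
  have "packing {}" by (simp add: packing_def)
  have "finite {F. packing F}"
    using packing_subset_Pow finite_V by (auto intro: finite_subset[of _ "Pow (Pow V)"])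
  then have "Max (weight ` {F. packing F}) \<in> weight ` {F. packing F}"
    and max: "\<And>G. packing G \<Longrightarrow> weight G \<le> Max (weight ` {F. packing F})"
    using \<open>packing {}\<close> by (auto intro!: Max_in Max_ge)
  then obtain F where F: "packing F" "weight F = Max (weight ` {F. packing F})" by auto
  \<comment> \<open>The second maximum ranges over pairs, so the final packing \<open>G\<close> may
    differ from \<open>F\<close> while having the same weight.\<close>
  let ?Q = "\<lambda>(G, Q). packing G \<and> weight G = weight F \<and> dipath E Q \<and> set Q \<subseteq> V - \<Union>G"
  have "?Q (F, [])" using F by (simp add: dipath_def)
  moreover have "length Q < Suc (card V)" if "?Q (G, Q)" for G Q
  proof -
    have "set Q \<subseteq> V" "distinct Q" using that by (auto simp: dipath_def)
    then show ?thesis using card_mono[OF finite_V, of "set Q"] by (simp add: distinct_card)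
  qed
  ultimately obtain G P where "?Q (G, P)" "\<And>G' Q. ?Q (G', Q) \<Longrightarrow> length Q \<le> length P"
    using ex_has_greatest_nat[of ?Q "(F, [])" "\<lambda>(G, Q). length Q" "Suc (card V)"] by fastforce
  then have "optimal_packing V E G P"
    using max F by unfold_locales auto
  then show ?thesis by blast
qed

lemma exists_packing:
  assumes "V \<noteq> {}" "\<And>v. v \<in> V \<Longrightarrow> 2 * k \<le> Suc (card (E `` {v}))"
  shows "\<exists>F. packing F \<and> k \<le> card F"
proof (rule ccontr)
  assume none: "\<not> ?thesis"
  obtain F P where "optimal_packing V E F P" using exists_optimal_packing by blast
  then interpret optimal_packing V E F P .
  interpret small_optimal_packing V E F P k
    using none packing assms by unfold_locales auto
  show False by (rule contradiction)
qed

end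

section \<open>Digraphs\<close>

lemma near_directed_list_mono:
  assumes "near_directed_list E vs" "E \<subseteq> E'"
  shows "near_directed_list E' vs"
  using assms by (auto simp: near_directed_list_def dipath_conv_nth)

lemma cycle_set_mono: "cycle_set E X \<Longrightarrow> E \<subseteq> E' \<Longrightarrow> cycle_set E' X"
  using near_directed_list_mono unfolding cycle_set_def by blast

text \<open>Deleting both ends of a digon costs each vertex at most two out-neighbours, just what
  lowering \<open>k\<close> by one permits. Without digons the oriented case applies.\<close>

lemma exists_disjoint_cycle_sets:
  fixes V :: "'a set"
  assumes "finite V" "E \<subseteq> V \<times> V" "irrefl E" "V \<noteq> {}"
    and "\<And>v. v \<in> V \<Longrightarrow> 2 * k \<le> Suc (card (E `` {v}))"
  shows "\<exists>F. disjoint F \<and> (\<forall>X\<in>F. cycle_set E X \<and> X \<subseteq> V) \<and> finite F \<and> card F = k"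
  using assms
proof (induction k arbitrary: V E)
  case 0
  then show ?case by (intro exI[of _ "{}"]) auto
next
  case (Suc k)
  show ?case
  proof (cases "\<exists>u v. (u, v) \<in> E \<and> (v, u) \<in> E")
    case False
    then interpret oriented_graph V E using Suc.prems by unfold_locales auto
    obtain F where F: "packing F" "Suc k \<le> card F" using exists_packing Suc.prems by metis
    then obtain G where "G \<subseteq> F" "card G = Suc k" "finite G" by (metis obtain_subset_with_card_n)
    then show ?thesis
      using F(1) cycle_set_subset pairwise_subset[of disjnt F G] unfolding packing_def by blast
  next
    case True
    then obtain u v where uv: "(u, v) \<in> E" "(v, u) \<in> E" by blast
    then have "u \<noteq> v" using Suc.prems(3) by (auto simp: irrefl_def)
    have "near_directed_list E [u, v]"
      using uv \<open>u \<noteq> v\<close> by (auto simp: near_directed_list_def dipath_def)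
    then have digon: "cycle_set E {u, v}" by (force simp: cycle_set_def)
    have uvV: "u \<in> V" "v \<in> V" using uv Suc.prems(2) by auto
    let ?V = "V - {u, v}"
    let ?E = "E \<inter> ?V \<times> ?V"
    have "\<exists>F. disjoint F \<and> (\<forall>X\<in>F. cycle_set ?E X \<and> X \<subseteq> ?V) \<and> finite F \<and> card F = k"
    proof (cases "k = 0")
      case True
      then show ?thesis by (intro exI[of _ "{}"]) auto
    next
      case False
      show ?thesis
      proof (rule Suc.IH)
        show "finite ?V" using Suc.prems(1) by simp
        show "irrefl ?E" using Suc.prems(3) by (auto simp: irrefl_def)
        have fin: "finite (E `` {x})" for x
          using Suc.prems(1,2) by (auto intro: finite_subset[of _ V])
        show "?V \<noteq> {}"
        proof
          assume "?V = {}"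
          then have "E `` {u} \<subseteq> {v}" using Suc.prems(2,3) by (auto simp: irrefl_def)
          then have "card (E `` {u}) \<le> 1" using card_mono[of "{v}" "E `` {u}"] by simp
          then show False using Suc.prems(5)[OF uvV(1)] False by simp
        qed
        show "2 * k \<le> Suc (card (?E `` {x}))" if "x \<in> ?V" for x
        proof -
          have "?E `` {x} = E `` {x} - {u, v}" using that Suc.prems(2) by auto
          moreover have "card (E `` {x}) - card {u, v} \<le> card (E `` {x} - {u, v})"
            by (rule diff_card_le_card_Diff) simp
          moreover have "2 * Suc k \<le> Suc (card (E `` {x}))" using Suc.prems(5) that by simp
          ultimately show ?thesis using \<open>u \<noteq> v\<close> by simp
        qed
      qed auto
    qed
    then obtain F where F: "disjoint F" "\<forall>X\<in>F. cycle_set ?E X \<and> X \<subseteq> ?V" "finite F" "card F = k"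
      by blast
    have "{u, v} \<notin> F" using F(2) by auto
    show ?thesis
    proof (intro exI[of _ "insert {u, v} F"] conjI ballI)
      show "disjoint (insert {u, v} F)" using F(1,2) by (auto simp: pairwise_insert disjnt_def)
      show "card (insert {u, v} F) = Suc k" using F(3,4) \<open>{u, v} \<notin> F\<close> by simp
      fix X assume "X \<in> insert {u, v} F"
      then have "X = {u, v} \<or> cycle_set ?E X \<and> X \<subseteq> ?V" using F(2) by auto
      then show "cycle_set E X" "X \<subseteq> V" using digon uvV cycle_set_mono[of ?E X E] by auto
    qed (use F(3) in simp)
  qed
qed

lemma subgraph_with_proj:
  assumes "pair_wf_digraph D" "parcs C \<subseteq> parcs D" "pverts C \<subseteq> pverts D"
    and "parcs C \<subseteq> pverts C \<times> pverts C"
  shows "subgraph (with_proj C) (with_proj D)"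
proof -
  interpret pair_wf_digraph D by fact
  have "wf_digraph (with_proj C)" using assms(4) by unfold_locales auto
  then show ?thesis
    using assms wf_digraph by (auto simp: subgraph_def compatible_def)
qed

text \<open>The arcs of the path are kept and closed by whichever arc between the ends lies in
  \<open>D\<close>; if only the wrong direction is present, that is the arc to reverse.\<close>

lemma near_directed_cycle_of_cycle_set:
  assumes D: "pair_wf_digraph D" and "cycle_set (parcs D) X"
  shows "\<exists>C. pverts C = X \<and> subgraph (with_proj C) (with_proj D) \<and> near_directed_cycle C"
proof -
  obtain vs where vs: "near_directed_list (parcs D) vs" "set vs = X"
    using assms(2) by (auto simp: cycle_set_def)
  let ?l = "length vs"
  have l: "2 \<le> ?l" "distinct vs" "vs \<noteq> []" using vs(1)
    by (auto simp: near_directed_list_def dipath_def)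
  have path: "(vs ! i, vs ! Suc i) \<in> parcs D" if "Suc i < ?l" for i
    using that vs(1) by (simp add: near_directed_list_def dipath_conv_nth)
  have XD: "X \<subseteq> pverts D"
  proof
    fix x assume "x \<in> X"
    then obtain i where i: "i < ?l" "x = vs ! i" using vs(2) by (metis in_set_conv_nth)
    show "x \<in> pverts D"
    proof (cases "Suc i < ?l")
      case True
      then show ?thesis using path i pair_wf_digraph.arc_fst_in_verts[OF D] by fastforce
    next
      case False
      then obtain j where "i = Suc j" using i l by (cases i) auto
      then show ?thesis using path[of j] i pair_wf_digraph.arc_snd_in_verts[OF D] by fastforce
    qed
  qed
  have ends: "hd vs = vs ! 0" "last vs = vs ! (?l - 1)"
    using l by (auto simp: hd_conv_nth last_conv_nth)
  let ?A = "{(vs ! i, vs ! (Suc i mod ?l)) | i. i < ?l}"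
  let ?B = "{(vs ! i, vs ! Suc i) | i. Suc i < ?l}"
  have A: "?A = insert (last vs, hd vs) ?B"
  proof -
    have "{i. i < ?l} = insert (?l - 1) {i. Suc i < ?l}" using l by auto
    moreover have "?A = (\<lambda>i. (vs ! i, vs ! (Suc i mod ?l))) ` {i. i < ?l}" by auto
    moreover have "?B = (\<lambda>i. (vs ! i, vs ! (Suc i mod ?l))) ` {i. Suc i < ?l}" by force
    ultimately show ?thesis using l ends by simp
  qed
  have dir: "directed_cycle \<lparr>pverts = X, parcs = ?A\<rparr>"
    using l vs(2) by (auto simp: directed_cycle_def)
  have B: "?B \<subseteq> parcs D" "?B \<subseteq> X \<times> X" using path vs(2) by auto
  have endsX: "hd vs \<in> X" "last vs \<in> X" using l vs(2) by auto
  show ?thesis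
  proof (cases "(last vs, hd vs) \<in> parcs D")
    case True
    have "subgraph (with_proj \<lparr>pverts = X, parcs = ?A\<rparr>) (with_proj D)"
      using True B endsX XD unfolding A by (intro subgraph_with_proj[OF D]) auto
    then show ?thesis
      using dir by (intro exI[of _ "\<lparr>pverts = X, parcs = ?A\<rparr>"])
        (simp add: near_directed_cycle_def is_cycle_def)
  next
    case False
    then have short: "3 \<le> ?l" "(hd vs, last vs) \<in> parcs D"
      using vs(1) by (auto simp: near_directed_list_def)
    let ?C = "\<lparr>pverts = X, parcs = insert (hd vs, last vs) ?B\<rparr>"
    \<comment> \<open>At the last position, \<open>a\<close> picks the closing arc against the
      direction of the path.\<close>
    define a where "a i = (if Suc i < ?l then (vs ! i, vs ! Suc i) else (hd vs, last vs))" for i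
    have "a ` {..<?l} = insert (hd vs, last vs) ?B"
    proof -
      have "{..<?l} = insert (?l - 1) {i. Suc i < ?l}" using l by auto
      then have "a ` {..<?l} = insert (a (?l - 1)) (a ` {i. Suc i < ?l})" by (simp only: image_insert)
      moreover have "?B = a ` {i. Suc i < ?l}" by (force simp: a_def)
      moreover have "a (?l - 1) = (hd vs, last vs)" using l by (simp add: a_def)
      ultimately show ?thesis by simp
    qed
    moreover have "a i = (vs ! i, vs ! (Suc i mod ?l)) \<or> a i = (vs ! (Suc i mod ?l), vs ! i)"
      if "i < ?l" for i
    proof (cases "Suc i < ?l")
      case True
      then show ?thesis by (simp add: a_def)
    next
      case False
      then have i: "Suc i = ?l" using that by simp
      then have "?l - 1 = i" by linarith
      then have "last vs = vs ! i" using ends(2) by metis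
      then show ?thesis using ends(1) by (simp add: a_def i)
    qed
    ultimately have "is_cycle ?C"
      using short(1) l(2) vs(2) unfolding is_cycle_def by (intro disjI2 exI[of _ vs] exI[of _ a]) auto
    \<comment> \<open>Since the list has length at least 3, the ends are not consecutive, so
      reversing the closing arc leaves the path intact.\<close>
    moreover have "(hd vs, last vs) \<notin> ?B"
      using l short(1) by (auto simp: ends nth_eq_iff_index_eq)
    then have "reverse_arc (hd vs, last vs) ?C = \<lparr>pverts = X, parcs = ?A\<rparr>"
      unfolding A by (simp add: reverse_arc_def)
    then have "\<exists>e\<in>parcs ?C. directed_cycle (reverse_arc e ?C)"
      using dir by (intro bexI[of _ "(hd vs, last vs)"]) simp_all
    ultimately have "near_directed_cycle ?C" by (simp add: near_directed_cycle_def)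
    moreover have "subgraph (with_proj ?C) (with_proj D)"
      using short B endsX XD by (intro subgraph_with_proj[OF D]) auto
    ultimately show ?thesis by (intro exI[of _ ?C]) simp
  qed
qed

theorem theorem1:
  fixes k :: nat and D :: "'a pair_pre_digraph"
  assumes "k \<ge> 1"
    and "pair_digraph D"
    and "pverts D \<noteq> {}"
    and "min_out_degree D \<ge> 2 * k - 1"
  shows "\<exists>C :: nat \<Rightarrow> 'a pair_pre_digraph.
           (\<forall>i < k. subgraph (with_proj (C i)) (with_proj D) \<and> near_directed_cycle (C i)) \<and>
           disjoint_family_on (\<lambda>i. pverts (C i)) {..<k}"
proof -
  interpret pair_digraph D by fact
  have "2 * k \<le> Suc (card (parcs D `` {v}))" if "v \<in> pverts D" for v
    using assms(4) that unfolding min_out_degree_ge_iff[OF assms(2,3)]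
    by (auto simp: Image_singleton le_diff_conv)
  moreover have "irrefl (parcs D)" using pair_no_loops by (force simp: irrefl_def)
  moreover have "parcs D \<subseteq> pverts D \<times> pverts D" using in_arcsD1 in_arcsD2 by auto
  ultimately obtain F where F: "disjoint F" "\<forall>X\<in>F. cycle_set (parcs D) X \<and> X \<subseteq> pverts D"
    "finite F" "card F = k"
    using exists_disjoint_cycle_sets[OF pair_finite_verts, of "parcs D" k] assms(3) by blast
  \<comment> \<open>Indexing the members of \<open>F\<close> by a bijection makes distinct indices
    yield distinct, hence disjoint, vertex sets.\<close>
  obtain f where f: "bij_betw f {..<k} F"
    using F(3,4) by (metis ex_bij_betw_nat_finite lessThan_atLeast0)
  have "\<forall>i\<in>{..<k}. \<exists>C. pverts C = f i \<and> subgraph (with_proj C) (with_proj D) \<and> near_directed_cycle C"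
    using near_directed_cycle_of_cycle_set[OF pair_wf_digraph_axioms] F(2) bij_betwE[OF f] by blast
  then obtain C where C: "\<forall>i\<in>{..<k}. pverts (C i) = f i
      \<and> subgraph (with_proj (C i)) (with_proj D) \<and> near_directed_cycle (C i)"
    by metis
  have "disjoint_family_on (\<lambda>i. pverts (C i)) {..<k}"
    unfolding disjoint_family_on_def
  proof (intro ballI impI)
    fix i j assume ij: "i \<in> {..<k}" "j \<in> {..<k}" "i \<noteq> j"
    then have "f i \<noteq> f j" using f by (auto simp: bij_betw_def inj_on_def)
    then have "f i \<inter> f j = {}" using disjointD[OF F(1)] bij_betwE[OF f] ij by blast
    then show "pverts (C i) \<inter> pverts (C j) = {}" using C ij by auto
  qed
  then show ?thesis using C by auto
qed

end
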